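(* Let $\hat\alpha:\mathbb N\to\mathbb N^+$ be a monotonically increasing, computable function that is not identical to $1$ and is in $o(\sqrt n)$. Then no algorithm that lists all triangles for input graphs $G=(V,E)$ with arboricity of at most $\hat\alpha(|E|)$ can run in $o(|E|\,\hat\alpha(|E|))$ time.
   Context: The arboricity of an undirected graph $G$ is the minimum number of edge-disjoint forests needed to cover the edges of $G$. "Monotonically increasing" is meant in the weak sense (nondecreasing). The algorithm is only required to be correct on graphs $G=(V,E)$ with arboricity at most $\hat\alpha(|E|)$; listing all triangles means outputting every triangle, and outputting a triangle takes at least one step. *)

theory Defs
  imports Complex_Main "HOL-Library.Landau_Symbols" "HOL-Library.Disjoint_Sets"
    "HOL-Library.Nat_Bijection"
begin

section \<open>Computable functions\<close>

datatype recf =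
    Zero
  | Succ
  | Proj nat
  | Comp recf "recf list"
  | PrimRec recf recf
  | Mu recf

text \<open>
  Big-step semantics of partial (mu-)recursive functions; a program diverges on an argument list
  iff it is related to no value. Primitive recursion and minimisation work on the first argument.
\<close>

inductive recf_eval :: "recf \<Rightarrow> nat list \<Rightarrow> nat \<Rightarrow> bool" where
  zero: "recf_eval Zero xs 0"
| succ: "recf_eval Succ [x] (Suc x)"
| proj: "i < length xs \<Longrightarrow> recf_eval (Proj i) xs (xs ! i)"
| comp: "length ys = length gs \<Longrightarrow> (\<forall>i<length gs. recf_eval (gs ! i) xs (ys ! i)) \<Longrightarrow>
    recf_eval f ys z \<Longrightarrow> recf_eval (Comp f gs) xs z"
| primrec_0: "recf_eval f xs y \<Longrightarrow> recf_eval (PrimRec f g) (0 # xs) y"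
| primrec_Suc: "recf_eval (PrimRec f g) (n # xs) y \<Longrightarrow> recf_eval g (n # y # xs) z \<Longrightarrow>
    recf_eval (PrimRec f g) (Suc n # xs) z"
| mu: "recf_eval f (n # xs) 0 \<Longrightarrow> (\<forall>k<n. \<exists>y. recf_eval f (k # xs) (Suc y)) \<Longrightarrow>
    recf_eval (Mu f) xs n"

inductive_cases recf_evalE:
  "recf_eval Zero xs z"
  "recf_eval Succ xs z"
  "recf_eval (Proj i) xs z"
  "recf_eval (Comp f gs) xs z"
  "recf_eval (PrimRec f g) (0 # xs) z"
  "recf_eval (PrimRec f g) (Suc n # xs) z"
  "recf_eval (Mu f) xs z"

lemma recf_eval_deterministic:
  "recf_eval f xs y \<Longrightarrow> recf_eval f xs z \<Longrightarrow> y = z"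
proof (induction arbitrary: z rule: recf_eval.induct)
  case (zero xs)
  then show ?case by (rule recf_evalE(1)) simp
next
  case (succ x)
  then show ?case by (rule recf_evalE(2)) simp
next
  case (proj i xs)
  from proj(2) show ?case by (rule recf_evalE(3)) simp
next
  case (comp ys gs xs f y)
  from comp.prems obtain ys' where *: "length ys' = length gs"
    "\<forall>i<length gs. recf_eval (gs ! i) xs (ys' ! i)" "recf_eval f ys' z"
    by (rule recf_evalE(4))
  have "ys = ys'"
  proof (rule nth_equalityI)
    show "length ys = length ys'" using comp.hyps * by simp
    show "ys ! i = ys' ! i" if "i < length ys" for i
      using that comp.IH(1) comp.hyps(1) *(2) by metis
  qed
  then show ?case using comp.IH(2) *(3) by blast
next
  case (primrec_0 f xs y g)
  from primrec_0.prems have "recf_eval f xs z" by (rule recf_evalE(5))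
  then show ?case by (rule primrec_0.IH)
next
  case (primrec_Suc f g n xs y w)
  from primrec_Suc.prems obtain y' where
    "recf_eval (PrimRec f g) (n # xs) y'" "recf_eval g (n # y' # xs) z"
    by (rule recf_evalE(6))
  then show ?case using primrec_Suc.IH by blast
next
  case (mu f n xs)
  from mu.prems have *: "recf_eval f (z # xs) 0" "\<forall>k<z. \<exists>y. recf_eval f (k # xs) (Suc y)"
    by (rule recf_evalE(7), blast)+
  have "\<not> z < n" using mu.IH(2) *(1) by blast
  moreover have "\<not> n < z" using mu.IH(1) *(2) by blast
  ultimately show ?case by simp
qed

definition computable :: "(nat \<Rightarrow> nat) \<Rightarrow> bool" where
  "computable f \<longleftrightarrow> (\<exists>p. \<forall>n. recf_eval p [n] (f n))"


section \<open>Graphs, triangles and arboricity\<close>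

text \<open>Vertices are natural numbers so that graphs can serve as inputs of an algorithm.\<close>

definition simple_graph :: "nat set \<Rightarrow> nat set set \<Rightarrow> bool" where
  "simple_graph V E \<longleftrightarrow> finite V \<and> (\<forall>e\<in>E. e \<subseteq> V \<and> card e = 2)"

definition triangles :: "nat set set \<Rightarrow> nat set set" where
  "triangles E = {T. card T = 3 \<and> (\<forall>u\<in>T. \<forall>v\<in>T. u \<noteq> v \<longrightarrow> {u, v} \<in> E)}"

definition is_cycle :: "nat set set \<Rightarrow> nat list \<Rightarrow> bool" where
  "is_cycle E c \<longleftrightarrow> 3 \<le> length c \<and> distinct c \<and>
     (\<forall>i<length c. {c ! i, c ! (Suc i mod length c)} \<in> E)"

definition forest :: "nat set set \<Rightarrow> bool" where
  "forest E \<longleftrightarrow> (\<nexists>c. is_cycle E c)"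

definition arboricity :: "nat set set \<Rightarrow> nat" where
  "arboricity E = (LEAST k. \<exists>F :: nat \<Rightarrow> nat set set.
     (\<forall>i<k. forest (F i)) \<and> disjoint_family_on F {..<k} \<and> (\<Union>i<k. F i) = E)"


section \<open>Algorithms\<close>

text \<open>
  No particular machine model is fixed. An algorithm is any deterministic step-by-step procedure
  that is effective: configurations are (coded as) natural numbers, and loading the input,
  performing one step, testing for termination and reading off the output of a step are all
  computable. Every step costs one time unit and outputs at most one vertex triple. Programs of
  Turing machines, random access machines (with any word size and any effective instruction set)
  and similar models are instances, so excluding all these procedures excludes algorithms in each
  of these models. Nothing is charged for loading the input, and a step may do an arbitrary
  amount of work; this only enlarges the class of procedures that are excluded.
\<close>

record algorithm =
  start :: "nat \<Rightarrow> nat"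
  step :: "nat \<Rightarrow> nat"
  halted :: "nat \<Rightarrow> bool"
  emit :: "nat \<Rightarrow> (nat \<times> nat \<times> nat) option"

fun emit_code :: "(nat \<times> nat \<times> nat) option \<Rightarrow> nat" where
  "emit_code None = 0"
| "emit_code (Some (a, b, c)) = Suc (prod_encode (a, prod_encode (b, c)))"

definition effective :: "algorithm \<Rightarrow> bool" where
  "effective A \<longleftrightarrow> computable (start A) \<and> computable (step A) \<and>
     computable (\<lambda>c. of_bool (halted A c)) \<and> computable (\<lambda>c. emit_code (emit A c))"

text \<open>
  An injective coding of finite graphs. The magnitude of the code is immaterial, because
  \<open>start\<close> may transform it into any other effective representation of the graph.
\<close>

definition graph_code :: "nat set \<Rightarrow> nat set set \<Rightarrow> nat" where
  "graph_code V E = prod_encode (set_encode V, set_encode (set_encode ` E))"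

definition configuration :: "algorithm \<Rightarrow> nat set \<Rightarrow> nat set set \<Rightarrow> nat \<Rightarrow> nat" where
  "configuration A V E t = (step A ^^ t) (start A (graph_code V E))"

definition terminates :: "algorithm \<Rightarrow> nat set \<Rightarrow> nat set set \<Rightarrow> bool" where
  "terminates A V E \<longleftrightarrow> (\<exists>t. halted A (configuration A V E t))"

text \<open>Only meaningful if the run terminates.\<close>

definition running_time :: "algorithm \<Rightarrow> nat set \<Rightarrow> nat set set \<Rightarrow> nat" where
  "running_time A V E = (LEAST t. halted A (configuration A V E t))"

definition listed :: "algorithm \<Rightarrow> nat set \<Rightarrow> nat set set \<Rightarrow> nat set set" where
  "listed A V E = {{a, b, c} | a b c.
     \<exists>t<running_time A V E. emit A (configuration A V E t) = Some (a, b, c)}"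

text \<open>Outputting a triangle repeatedly, or triples that are not triangles, is tolerated.\<close>

definition lists_all_triangles :: "algorithm \<Rightarrow> nat set \<Rightarrow> nat set set \<Rightarrow> bool" where
  "lists_all_triangles A V E \<longleftrightarrow> terminates A V E \<and> triangles E \<subseteq> listed A V E"

definition admissible :: "(nat \<Rightarrow> nat) \<Rightarrow> nat set \<Rightarrow> nat set set \<Rightarrow> bool" where
  "admissible \<alpha> V E \<longleftrightarrow> simple_graph V E \<and> arboricity E \<le> \<alpha> (card E)"

text \<open>
  Worst-case running time over the graphs satisfying \<open>P\<close>, measured in the number of edges.
  The bound is only demanded for all sufficiently large numbers of edges.
\<close>

definition runs_in_little_o ::
  "algorithm \<Rightarrow> (nat set \<Rightarrow> nat set set \<Rightarrow> bool) \<Rightarrow> (nat \<Rightarrow> real) \<Rightarrow> bool" where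
  "runs_in_little_o A P f \<longleftrightarrow> (\<exists>T \<in> o(f). \<forall>\<^sub>F m in sequentially.
     \<forall>V E. P V E \<and> card E = m \<longrightarrow> terminates A V E \<and> real (running_time A V E) \<le> T m)"

end

theory Submission imports Defs begin

text \<open>
  Only the size of the output matters: every step emits at most one triple, so the running time is
  at least the number of triangles. For \<open>k = \<alpha> m\<close>, join each of the vertices \<open>k, k + 1, \<dots>\<close> to its
  \<open>k\<close> immediate predecessors until \<open>m\<close> edges are used up. The edges joining vertices at a fixed
  distance form a forest, so the arboricity is at most \<open>k\<close>, while about \<open>m / k - k\<close> vertices are each
  the largest vertex of \<open>k choose 2\<close> triangles. As \<open>k \<ge> 2\<close> and \<open>k = o(sqrt m)\<close>, this gives a constant
  fraction of \<open>m * k\<close> triangles.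
\<close>

text \<open>The largest vertex of a cycle has two distinct neighbours on the cycle, both smaller
  than it.\<close>

lemma forest_if_unique_smaller_neighbour:
  assumes "\<And>u v w. {u, w} \<in> E \<Longrightarrow> {v, w} \<in> E \<Longrightarrow> u < w \<Longrightarrow> v < w \<Longrightarrow> u = v"
  shows "forest E"
  unfolding forest_def
proof
  assume "\<exists>c. is_cycle E c"
  then obtain c where len: "3 \<le> length c" and dist: "distinct c"
    and edges: "\<And>i. i < length c \<Longrightarrow> {c ! i, c ! (Suc i mod length c)} \<in> E"
    unfolding is_cycle_def by blast
  have "Max (set c) \<in> set c" using len by (intro Max_in) auto
  then obtain p where p: "p < length c" "c ! p = Max (set c)"
    by (auto simp: in_set_conv_nth)
  \<comment> \<open>\<open>s\<close> and \<open>r\<close> are the cyclic successor and predecessor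
    of the position \<open>p\<close>; they differ because the cycle has length at least 3.\<close>
  define s where "s = Suc p mod length c"
  define r where "r = (if p = 0 then length c - 1 else p - 1)"
  have s: "s < length c" "s \<noteq> p" and r: "r < length c" "r \<noteq> p" and "r \<noteq> s"
    and r_p: "Suc r mod length c = p"
    using p len by (auto simp: s_def r_def mod_Suc)
  have less: "c ! i < c ! p" if "i < length c" "i \<noteq> p" for i
    using that p dist by (metis List.finite_set Max_ge nat_less_le nth_eq_iff_index_eq nth_mem)
  have "{c ! s, c ! p} \<in> E" using edges[OF p(1)] by (simp add: s_def insert_commute)
  moreover have "{c ! r, c ! p} \<in> E" using edges[OF r(1)] r_p by simp
  ultimately have "c ! s = c ! r" using assms less s r by blast
  with \<open>r \<noteq> s\<close> s r dist show False by (simp add: nth_eq_iff_index_eq)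
qed

lemma arboricity_le:
  assumes "\<And>i. i < k \<Longrightarrow> forest (F i)" "disjoint_family_on F {..<k}" "(\<Union>i<k. F i) = E"
  shows "arboricity E \<le> k"
  unfolding arboricity_def using assms by (intro Least_le) blast

text \<open>Each step before halting contributes at most one triple. Silent steps are mapped to
  \<open>{}\<close>, which only enlarges the covering image.\<close>

lemma finite_listed: "finite (listed A V E)"
  and card_listed_le: "card (listed A V E) \<le> running_time A V E"
proof -
  have "listed A V E \<subseteq> (\<lambda>t. case emit A (configuration A V E t) of
      Some (a, b, c) \<Rightarrow> {a, b, c} | None \<Rightarrow> {}) ` {..<running_time A V E}"
    unfolding listed_def by (force split: option.splits)
  then show "finite (listed A V E)" "card (listed A V E) \<le> running_time A V E"
    using surj_card_le[of "{..<running_time A V E}"] by (auto intro: finite_subset)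
qed

lemma card_triangles_le_running_time:
  assumes "lists_all_triangles A V E"
  shows "card (triangles E) \<le> running_time A V E"
  using assms card_mono[OF finite_listed] card_listed_le order_trans
  unfolding lists_all_triangles_def by blast


text \<open>Numbering the edges makes every edge count \<open>m\<close> attainable. The quotient of
  \<open>e\<close> by \<open>k\<close> selects the larger endpoint, the remainder one of its
  \<open>k\<close> immediate predecessors. For \<open>k > 0\<close> the subtraction never
  truncates.\<close>

definition back_edge :: "nat \<Rightarrow> nat \<Rightarrow> nat set" where
  "back_edge k e = {e div k + (k - Suc (e mod k)), e div k + k}"

definition back_edges :: "nat \<Rightarrow> nat \<Rightarrow> nat set set" where
  "back_edges k m = back_edge k ` {..<m}"

text \<open>\<open>Suc\<close> turns the remainders 0 to \<open>k - 1\<close> into the distances 1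
  to \<open>k\<close>, so an edge determines the quotient and remainder of its number.\<close>

lemma back_edge_eq_iff:
  assumes "k > 0" "u < v"
  shows "{u, v} = back_edge k e \<longleftrightarrow> v = e div k + k \<and> v = u + Suc (e mod k)"
proof -
  have "e mod k < k" using assms by simp
  then show ?thesis using assms unfolding back_edge_def doubleton_eq_iff by linarith
qed

lemma inj_back_edge:
  assumes "k > 0"
  shows "inj (back_edge k)"
proof (rule injI)
  fix d e assume "back_edge k d = back_edge k e"
  moreover have "d div k + (k - Suc (d mod k)) < d div k + k" using assms by simp
  ultimately have "d div k + k = e div k + k"
    "d div k + k = d div k + (k - Suc (d mod k)) + Suc (e mod k)"
    using back_edge_eq_iff[OF assms, of "d div k + (k - Suc (d mod k))" "d div k + k" e]
    unfolding back_edge_def[of k d] by blast+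
  moreover have "d mod k < k" using assms by simp
  ultimately have "d div k = e div k" "d mod k = e mod k" by linarith+
  then show "d = e" by (metis div_mult_mod_eq)
qed

lemma card_back_edges: "k > 0 \<Longrightarrow> card (back_edges k m) = m"
  unfolding back_edges_def by (simp add: card_image inj_on_subset[OF inj_back_edge])

lemma simple_graph_back_edges:
  assumes "k > 0"
  shows "simple_graph {..<m + k} (back_edges k m)"
  unfolding simple_graph_def
proof (intro conjI ballI)
  fix b assume "b \<in> back_edges k m"
  then obtain e where e: "e < m" "b = back_edge k e" by (auto simp: back_edges_def)
  have "e div k \<le> e" by simp
  with e(1) have "e div k < m" by linarith
  then show "b \<subseteq> {..<m + k}" using assms by (auto simp: e(2) back_edge_def)
  have "e mod k < k" using assms by simp
  then show "card b = 2" using e(2) by (simp add: back_edge_def)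
qed simp

lemma arboricity_back_edges:
  assumes "k > 0"
  shows "arboricity (back_edges k m) \<le> k"
proof (rule arboricity_le)
  \<comment> \<open>A common remainder \<open>i\<close> means a common distance
    \<open>Suc i\<close>, so the larger endpoint fixes the smaller one.\<close>
  define F where "F i = back_edge k ` {e. e < m \<and> e mod k = i}" for i
  show "forest (F i)" for i
  proof (rule forest_if_unique_smaller_neighbour)
    fix u v w assume *: "{u, w} \<in> F i" "{v, w} \<in> F i" "u < w" "v < w"
    have "w = x + Suc i" if "{x, w} \<in> F i" "x < w" for x
      using that back_edge_eq_iff[OF assms] by (auto simp: F_def)
    from this[OF *(1,3)] this[OF *(2,4)] show "u = v" by simp
  qed
  show "disjoint_family_on F {..<k}"
    using inj_back_edge[OF assms] by (auto simp: disjoint_family_on_def F_def dest: injD)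
  show "(\<Union>i<k. F i) = back_edges k m"
    using assms unfolding F_def back_edges_def image_UN[symmetric]
    by (intro arg_cong[of _ _ "image (back_edge k)"]) auto
qed

text \<open>The bound \<open>v < k + m div k\<close> singles out vertices whose whole block of
  \<open>k\<close> edge numbers lies below \<open>m\<close>.\<close>

lemma mem_back_edges:
  assumes "u < v" "v \<le> u + k" "k \<le> v" "v < k + m div k"
  shows "{u, v} \<in> back_edges k m"
proof -
  have "k > 0" using assms by simp
  define e where "e = (v - k) * k + (v - Suc u)"
  have "v - Suc u < k" using assms by simp
  then have e: "e div k = v - k" "e mod k = v - Suc u" by (simp_all add: e_def)
  have "{u, v} = back_edge k e"
    unfolding back_edge_eq_iff[OF \<open>k > 0\<close> assms(1)] e using assms by simp
  moreover have "e < m"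
  proof -
    have "e div k < m div k" using assms by (simp add: e)
    then show ?thesis by (meson div_le_mono leD leI)
  qed
  ultimately show ?thesis by (auto simp: back_edges_def)
qed

lemma finite_triangles:
  assumes "simple_graph V E"
  shows "finite (triangles E)"
proof (rule finite_subset)
  show "triangles E \<subseteq> Pow V"
  proof
    fix T assume T: "T \<in> triangles E"
    have "u \<in> V" if "u \<in> T" for u
    proof -
      have "card T = 3" using T by (simp add: triangles_def)
      then have "\<not> T \<subseteq> {u}" using card_mono[of "{u}" T] by auto
      then obtain v where "v \<in> T" "u \<noteq> v" by blast
      with T that have "{u, v} \<in> E" by (simp add: triangles_def)
      with assms show "u \<in> V" by (auto simp: simple_graph_def)
    qed
    then show "T \<in> Pow V" by blast
  qed
  show "finite (Pow V)" using assms by (simp add: simple_graph_def)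
qed

lemma card_triangles_back_edges:
  assumes "k > 0"
  shows "(m div k - k) * (k choose 2) \<le> card (triangles (back_edges k m))"
proof -
  \<comment> \<open>A triangle is encoded by its largest vertex \<open>v\<close> and the pair
    \<open>S\<close> of the other two. Starting at \<open>2 * k\<close> keeps all \<open>k\<close>
    predecessors of \<open>v\<close> at or above \<open>k\<close>, so they are also joined to each
    other.\<close>
  define X where
    "X = Sigma {2 * k..<k + m div k} (\<lambda>v. {S. S \<subseteq> {v - k..<v} \<and> card S = 2})"
  have "inj_on (\<lambda>(v, S). insert v S) X"
  proof (rule inj_onI, clarsimp simp: X_def)
    fix v w S S'
    assume S: "S \<subseteq> {v - k..<v}" "S' \<subseteq> {w - k..<w}" and eq: "insert v S = insert w S'"
    \<comment> \<open>Both \<open>v\<close> and \<open>w\<close> are the maximum of the same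
      set.\<close>
    have "v \<in> insert w S'" "w \<in> insert v S" using eq by blast+
    with S have "v \<le> w" "w \<le> v" by auto
    with S eq show "v = w \<and> S = S'"
      by (metis atLeastLessThan_iff insert_ident le_antisym less_irrefl subsetD)
  qed
  moreover have "(\<lambda>(v, S). insert v S) ` X \<subseteq> triangles (back_edges k m)"
  proof (clarsimp simp: X_def)
    fix v S
    assume v: "2 * k \<le> v" "v < k + m div k" and S: "S \<subseteq> {v - k..<v}" "card S = 2"
    have "finite S" using S(1) finite_subset by blast
    moreover have "v \<notin> S" using S(1) by auto
    ultimately have "card (insert v S) = 3" using S(2) by simp
    moreover have less: "{x, y} \<in> back_edges k m" if "x \<in> insert v S" "y \<in> insert v S" "x < y" for x y
    proof (rule mem_back_edges)
      have "v - k \<le> x" "y \<le> v" "v - k \<le> y" using that S(1) v by auto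
      then show "y \<le> x + k" "k \<le> y" "y < k + m div k" using v by linarith+
    qed (fact that)
    then have "{x, y} \<in> back_edges k m" if "x \<in> insert v S" "y \<in> insert v S" "x \<noteq> y" for x y
      using that by (metis insert_commute linorder_neqE_nat)
    ultimately show "insert v S \<in> triangles (back_edges k m)"
      unfolding triangles_def by blast
  qed
  ultimately have "card X \<le> card (triangles (back_edges k m))"
    using finite_triangles[OF simple_graph_back_edges[OF assms]] by (intro card_inj_on_le) auto
  moreover have "card X = (\<Sum>v\<in>{2 * k..<k + m div k}. k choose 2)"
    unfolding X_def by (subst card_SigmaI) (auto simp: n_subsets intro!: sum.cong)
  ultimately show ?thesis by simp
qed

lemma many_triangles_back_edges:
  assumes "2 \<le> k" "4 * real k \<le> sqrt (real m)"
  shows "real m * real k / 8 \<le> real (card (triangles (back_edges k m)))"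
proof -
  have "(4 * real k)\<^sup>2 \<le> (sqrt (real m))\<^sup>2" using assms(2) by (intro power_mono) auto
  then have m: "16 * (real k)\<^sup>2 \<le> real m" by (simp add: power_mult_distrib)
  have pairs: "real (k choose 2) = real k * (real k - 1) / 2"
    using assms(1) by (simp add: choose_two real_of_nat_div of_nat_diff)
  \<comment> \<open>Rounding down loses at most 1, and truncated subtraction can only increase the
    right-hand side.\<close>
  have "real m / real k - 1 - real k \<le> real (m div k - k)"
    using floor_divide_of_nat_eq[of m k, where 'a = real] by linarith
  \<comment> \<open>This is \<open>k - 1 \<ge> k / 2\<close>, which needs
    \<open>2 \<le> k\<close>.\<close>
  moreover have "real k / 2 * (real k / 2) \<le> real (k choose 2)"
    unfolding pairs using assms(1) by (simp add: field_simps)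
  moreover have "0 \<le> real m / real k - 1 - real k"
  proof -
    have "(1 + real k) * real k \<le> 16 * (real k)\<^sup>2"
      using assms(1) by (simp add: power2_eq_square algebra_simps)
    with m have "(1 + real k) * real k \<le> real m" by linarith
    then have "1 + real k \<le> real m / real k" using assms(1) by (simp add: pos_le_divide_eq)
    then show ?thesis by simp
  qed
  ultimately have "(real m / real k - 1 - real k) * (real k / 2 * (real k / 2))
      \<le> real (m div k - k) * real (k choose 2)"
    by (intro mult_mono) auto
  also have "\<dots> \<le> real (card (triangles (back_edges k m)))"
    using card_triangles_back_edges[of k m] assms(1) by (simp flip: of_nat_mult)
  also have "(real m / real k - 1 - real k) * (real k / 2 * (real k / 2)) =
      (real m * real k - (1 + real k) * (real k)\<^sup>2) / 4"
    using assms(1) by (simp add: field_simps power2_eq_square)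
  finally have "(real m * real k - (1 + real k) * (real k)\<^sup>2) / 4
      \<le> real (card (triangles (back_edges k m)))" .
  \<comment> \<open>The cubic error term uses up at most half of the main term, leaving the factor
    1/8.\<close>
  moreover have "(1 + real k) * (real k)\<^sup>2 \<le> real m * real k / 2"
  proof -
    have "(1 + real k) * (real k)\<^sup>2 \<le> (2 * real k) * (real k)\<^sup>2"
      using assms(1) by (intro mult_right_mono) auto
    also have "\<dots> \<le> (2 * real k) * (real m / 16)" using m by (intro mult_left_mono) auto
    also have "\<dots> \<le> real m * real k / 2" by simp
    finally show ?thesis .
  qed
  ultimately show ?thesis by argo
qed

theorem theorem19:
  fixes \<alpha> :: "nat \<Rightarrow> nat"
  assumes "\<And>n. \<alpha> n > 0"
    and "mono \<alpha>"
    and "computable \<alpha>"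
    and "\<alpha> \<noteq> (\<lambda>_. 1)"
    and "(\<lambda>n. real (\<alpha> n)) \<in> o(\<lambda>n. sqrt (real n))"
  shows "\<not> (\<exists>A. effective A \<and>
    (\<forall>V E. admissible \<alpha> V E \<longrightarrow> lists_all_triangles A V E) \<and>
    runs_in_little_o A (admissible \<alpha>) (\<lambda>m. real m * real (\<alpha> m)))"
proof
  assume "\<exists>A. effective A \<and>
    (\<forall>V E. admissible \<alpha> V E \<longrightarrow> lists_all_triangles A V E) \<and>
    runs_in_little_o A (admissible \<alpha>) (\<lambda>m. real m * real (\<alpha> m))"
  then obtain A T where
    correct: "\<And>V E. admissible \<alpha> V E \<Longrightarrow> lists_all_triangles A V E" and
    T: "T \<in> o(\<lambda>m. real m * real (\<alpha> m))" and
    fast: "\<forall>\<^sub>F m in sequentially. \<forall>V E. admissible \<alpha> V E \<and> card E = m \<longrightarrow>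
      terminates A V E \<and> real (running_time A V E) \<le> T m"
    unfolding runs_in_little_o_def by blast
  \<comment> \<open>A positive value other than 1 is at least 2, and monotonicity preserves this
    bound for all later arguments.\<close>
  obtain n where "\<alpha> n \<noteq> 1" using assms(4) by blast
  with assms(1)[of n] have "2 \<le> \<alpha> n" by linarith
  then have "\<forall>\<^sub>F m in sequentially. 2 \<le> \<alpha> m"
    using monoD[OF assms(2)] order_trans unfolding eventually_sequentially by blast
  \<comment> \<open>Any constant below the 1/8 of \<open>many_triangles_back_edges\<close> would
    contradict it; the 1/4 below matches its hypothesis
    \<open>4 * real k \<le> sqrt (real m)\<close>.\<close>
  moreover have "\<forall>\<^sub>F m in sequentially. norm (T m) \<le> 1 / 16 * norm (real m * real (\<alpha> m))"
    using landau_o.smallD[OF T, of "1 / 16"] by simp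
  moreover have "\<forall>\<^sub>F m in sequentially. norm (real (\<alpha> m)) \<le> 1 / 4 * norm (sqrt (real m))"
    using landau_o.smallD[OF assms(5), of "1 / 4"] by simp
  ultimately have "\<forall>\<^sub>F m in sequentially. False"
    using fast eventually_gt_at_top[of 0]
  proof eventually_elim
    case (elim m)
    \<comment> \<open>This graph has exactly \<open>m\<close> edges, so the arboricity allowed for
      it is \<open>\<alpha> m\<close>, the very parameter it is built with.\<close>
    let ?E = "back_edges (\<alpha> m) m" and ?V = "{..<m + \<alpha> m}"
    have "admissible \<alpha> ?V ?E"
      unfolding admissible_def card_back_edges[OF assms(1)]
      using simple_graph_back_edges[OF assms(1)] arboricity_back_edges[OF assms(1)] by blast
    with correct elim(4) card_back_edges[OF assms(1)]
    have "card (triangles ?E) \<le> running_time A ?V ?E" "real (running_time A ?V ?E) \<le> T m"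
      using card_triangles_le_running_time by blast+
    moreover have "real m * real (\<alpha> m) / 8 \<le> real (card (triangles ?E))"
      using elim(1,3) by (intro many_triangles_back_edges) auto
    moreover have "T m \<le> real m * real (\<alpha> m) / 16" using elim(2) by simp
    moreover have "0 < real m * real (\<alpha> m)" using elim(5) assms(1) by simp
    ultimately show False by linarith
  qed
  then show False by simp
qed

end
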